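(* Grigorchuk's group $G$ embeds into the topological full group $[[T]]$ of the subshift $(\Omega_\tau,T)$, i.e. $G$ is isomorphic to a subgroup of $[[T]]$.
   Context: $G$ is the group of automorphisms of the rooted binary tree with vertex set $\{0,1\}^*$ generated by the involutions $a,b,c,d$ given by $a(0w)=1w$, $a(1w)=0w$; $b(0w)=0a(w)$, $b(1w)=1c(w)$; $c(0w)=0a(w)$, $c(1w)=1d(w)$; $d(0w)=0w$, $d(1w)=1b(w)$. Let $\mathcal A=\{a,x,y,z\}$ and let $\tau$ be the substitution $a\mapsto axa$, $x\mapsto y$, $y\mapsto z$, $z\mapsto x$, extended to words by concatenation. $\mathrm{Sub}_\tau$ is the set of all finite subwords (blocks of consecutive letters, including the empty word) of the words $\tau^n(s)$, $s\in\mathcal A$, $n\ge 0$. Let $\Omega_\tau=\{\omega\in\mathcal A^{\mathbb Z}: \text{every finite subword of }\omega\text{ belongs to }\mathrm{Sub}_\tau\}$, with the product topology of the discrete topologies, and $(T\omega)(n)=\omega(n+1)$. The topological full group $[[T]]$ is the group of all homeomorphisms $S$ of $\Omega_\tau$ for which there is a continuous map $m:\Omega_\tau\to\mathbb Z$ with $S\omega=T^{m(\omega)}\omega$ for all $\omega\in\Omega_\tau$. *)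

theory Defs
  imports
    "HOL-Analysis.Function_Topology"
    "HOL-Algebra.Bij"
    "HOL-Algebra.Generated_Groups"
    "HOL-Library.Sublist"
begin

section \<open>Grigorchuk's group\<close>

datatype bin = B0 | B1

definition tree_adj :: "bin list \<Rightarrow> bin list \<Rightarrow> bool" where
  "tree_adj u v \<longleftrightarrow> (\<exists>x. v = u @ [x] \<or> u = v @ [x])"

definition tree_auts :: "(bin list \<Rightarrow> bin list) set" where
  "tree_auts = {f. bij f \<and> f [] = [] \<and> (\<forall>u v. tree_adj (f u) (f v) \<longleftrightarrow> tree_adj u v)}"

definition tree_aut_group :: "(bin list \<Rightarrow> bin list) monoid" where
  "tree_aut_group = (BijGroup UNIV)\<lparr>carrier := tree_auts\<rparr>"

fun grig_a :: "bin list \<Rightarrow> bin list" where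
  "grig_a [] = []"
| "grig_a (B0 # w) = B1 # w"
| "grig_a (B1 # w) = B0 # w"

fun grig_b grig_c grig_d :: "bin list \<Rightarrow> bin list" where
  "grig_b [] = []"
| "grig_b (B0 # w) = B0 # grig_a w"
| "grig_b (B1 # w) = B1 # grig_c w"
| "grig_c [] = []"
| "grig_c (B0 # w) = B0 # grig_a w"
| "grig_c (B1 # w) = B1 # grig_d w"
| "grig_d [] = []"
| "grig_d (B0 # w) = B0 # w"
| "grig_d (B1 # w) = B1 # grig_b w"

definition grigorchuk_group :: "(bin list \<Rightarrow> bin list) monoid" where
  "grigorchuk_group =
     tree_aut_group\<lparr>carrier := generate tree_aut_group {grig_a, grig_b, grig_c, grig_d}\<rparr>"

lemma subgroup_tree_auts: "subgroup tree_auts (BijGroup UNIV)"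
proof (rule group.subgroupI[OF group_BijGroup])
  show "tree_auts \<subseteq> carrier (BijGroup UNIV)"
    by (auto simp: tree_auts_def BijGroup_def Bij_def extensional_def)
  have "id \<in> tree_auts" by (simp add: tree_auts_def)
  then show "tree_auts \<noteq> {}" by blast
next
  fix f assume f: "f \<in> tree_auts"
  then have B: "f \<in> Bij UNIV" and bij: "bij f"
    by (auto simp: tree_auts_def Bij_def extensional_def)
  have "inv\<^bsub>BijGroup UNIV\<^esub> f = inv_into UNIV f"
    using B by (simp add: inv_BijGroup fun_eq_iff)
  moreover have "inv_into UNIV f \<in> tree_auts"
    unfolding tree_auts_def
  proof (safe)
    show "bij (inv_into UNIV f)" using bij by (rule bij_imp_bij_inv)
    show "inv_into UNIV f [] = []" using f bij unfolding tree_auts_def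
      by (metis (mono_tags, lifting) bij_inv_eq_iff mem_Collect_eq)
    fix u v
    have "tree_adj (f (inv_into UNIV f u)) (f (inv_into UNIV f v)) \<longleftrightarrow> tree_adj (inv_into UNIV f u) (inv_into UNIV f v)"
      using f by (simp add: tree_auts_def)
    moreover have "f (inv_into UNIV f u) = u" "f (inv_into UNIV f v) = v"
      using bij by (simp_all add: bij_is_surj surj_f_inv_f)
    ultimately show "tree_adj (inv_into UNIV f u) (inv_into UNIV f v) \<Longrightarrow> tree_adj u v"
      and "tree_adj u v \<Longrightarrow> tree_adj (inv_into UNIV f u) (inv_into UNIV f v)" by auto
  qed
  ultimately show "inv\<^bsub>BijGroup UNIV\<^esub> f \<in> tree_auts" by simp
next
  fix f g assume "f \<in> tree_auts" "g \<in> tree_auts"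
  then show "f \<otimes>\<^bsub>BijGroup UNIV\<^esub> g \<in> tree_auts"
    by (auto simp: tree_auts_def BijGroup_def Bij_def extensional_def compose_def
        intro: bij_comp[unfolded comp_def])
qed

lemma group_tree_aut_group: "group tree_aut_group"
  unfolding tree_aut_group_def
  by (rule subgroup.subgroup_is_group[OF subgroup_tree_auts group_BijGroup])

lemma grig_involutions:
  "grig_a (grig_a w) = w" "grig_b (grig_b w) = w" "grig_c (grig_c w) = w" "grig_d (grig_d w) = w"
proof -
  show a: "grig_a (grig_a w) = w" for w by (cases w rule: grig_a.cases) auto
  show "grig_b (grig_b w) = w" "grig_c (grig_c w) = w" "grig_d (grig_d w) = w"
    by (induction w rule: grig_b_grig_c_grig_d.induct) (simp_all add: a)
qed

lemma tree_adj_simps: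
  "tree_adj (x # u) (y # v) \<longleftrightarrow> x = y \<and> tree_adj u v"
  "tree_adj [] (y # v) \<longleftrightarrow> v = []"
  "tree_adj (x # u) [] \<longleftrightarrow> u = []"
  by (auto simp: tree_adj_def)

lemma grig_eq_Nil [simp]:
  "grig_a w = [] \<longleftrightarrow> w = []" "grig_b w = [] \<longleftrightarrow> w = []"
  "grig_c w = [] \<longleftrightarrow> w = []" "grig_d w = [] \<longleftrightarrow> w = []"
  using grig_involutions[of w] by auto

lemma grig_tree_adj:
  "tree_adj (grig_a u) (grig_a v) \<longleftrightarrow> tree_adj u v"
  "tree_adj (grig_b u) (grig_b v) \<longleftrightarrow> tree_adj u v"
  "tree_adj (grig_c u) (grig_c v) \<longleftrightarrow> tree_adj u v"
  "tree_adj (grig_d u) (grig_d v) \<longleftrightarrow> tree_adj u v"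
proof -
  show a: "tree_adj (grig_a u) (grig_a v) \<longleftrightarrow> tree_adj u v" for u v
    by (cases u rule: grig_a.cases; cases v rule: grig_a.cases) (auto simp: tree_adj_simps)
  show "tree_adj (grig_b u) (grig_b v) \<longleftrightarrow> tree_adj u v"
    "tree_adj (grig_c u) (grig_c v) \<longleftrightarrow> tree_adj u v"
    "tree_adj (grig_d u) (grig_d v) \<longleftrightarrow> tree_adj u v"
  proof (induction u and u and u arbitrary: v and v and v rule: grig_b_grig_c_grig_d.induct)
  qed (case_tac [!] v rule: grig_a.cases, simp_all add: a tree_adj_simps)
qed

lemma grig_in_tree_auts: "{grig_a, grig_b, grig_c, grig_d} \<subseteq> carrier tree_aut_group"
  using grig_involutions
  by (auto simp: tree_aut_group_def tree_auts_def grig_tree_adj intro!: involuntory_imp_bij)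

lemma group_grigorchuk_group: "group grigorchuk_group"
  unfolding grigorchuk_group_def
  using group.generate_is_subgroup[OF group_tree_aut_group grig_in_tree_auts]
    subgroup.subgroup_is_group group_tree_aut_group by blast

section \<open>Topological full groups\<close>

definition homeo_group :: "'a topology \<Rightarrow> ('a \<Rightarrow> 'a) monoid" where
  "homeo_group X = (BijGroup (topspace X))
     \<lparr>carrier := {f \<in> extensional (topspace X). homeomorphic_map X X f}\<rparr>"

definition topological_full_group :: "'a topology \<Rightarrow> ('a \<Rightarrow> 'a) \<Rightarrow> ('a \<Rightarrow> 'a) monoid" where
  "topological_full_group X T = (homeo_group X)
     \<lparr>carrier := {S \<in> carrier (homeo_group X).
        \<exists>m :: 'a \<Rightarrow> int. continuous_map X (discrete_topology UNIV) m \<and>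
          (\<forall>x \<in> topspace X. S x = (T [^]\<^bsub>homeo_group X\<^esub> m x) x)}\<rparr>"

lemma subgroup_homeo:
  "subgroup {f \<in> extensional (topspace X). homeomorphic_map X X f} (BijGroup (topspace X))"
    (is "subgroup ?H _")
proof (rule group.subgroupI[OF group_BijGroup])
  show sub: "?H \<subseteq> carrier (BijGroup (topspace X))"
    using homeomorphic_imp_surjective_map homeomorphic_imp_injective_map
    by (fastforce simp: BijGroup_def Bij_def bij_betw_def)
  have "(\<lambda>x\<in>topspace X. x) \<in> ?H"
    using homeomorphic_map_eq[of X X id "\<lambda>x\<in>topspace X. x"] by simp
  then show "?H \<noteq> {}" by blast
  {
    fix f assume f: "f \<in> ?H"
    with sub have B: "f \<in> Bij (topspace X)" by (auto simp: BijGroup_def)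
    from f obtain g where g: "homeomorphic_maps X X f g"
      by (auto simp: homeomorphic_map_maps)
    have "inv_into (topspace X) f y = g y" if "y \<in> topspace X" for y
      using g f that unfolding homeomorphic_maps_def
      by (metis (mono_tags, lifting) continuous_map_image_subset_topspace image_subset_iff
          homeomorphic_imp_injective_map inv_into_f_eq mem_Collect_eq)
    moreover have "homeomorphic_map X X g"
      using g homeomorphic_map_maps homeomorphic_maps_sym by blast
    ultimately have "(\<lambda>x\<in>topspace X. inv_into (topspace X) f x) \<in> ?H"
      using homeomorphic_map_eq[of X X g "\<lambda>x\<in>topspace X. inv_into (topspace X) f x"] by simp
    then show "inv\<^bsub>BijGroup (topspace X)\<^esub> f \<in> ?H" using B by (simp add: inv_BijGroup)
  }
  fix f g assume f: "f \<in> ?H" and g: "g \<in> ?H"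
  with sub have B: "f \<in> Bij (topspace X)" "g \<in> Bij (topspace X)" by (auto simp: BijGroup_def)
  have "homeomorphic_map X X (f \<circ> g)"
    using f g homeomorphic_map_compose by blast
  then have "homeomorphic_map X X (compose (topspace X) f g)"
    by (rule homeomorphic_map_eq) (simp add: compose_def)
  then show "f \<otimes>\<^bsub>BijGroup (topspace X)\<^esub> g \<in> ?H"
    using B by (simp add: BijGroup_def)
qed

lemma group_homeo_group: "group (homeo_group X)"
  unfolding homeo_group_def
  by (rule subgroup.subgroup_is_group[OF subgroup_homeo group_BijGroup])

lemma homeo_group_simps:
  assumes "f \<in> carrier (homeo_group X)" "g \<in> carrier (homeo_group X)" "x \<in> topspace X"
  shows "(f \<otimes>\<^bsub>homeo_group X\<^esub> g) x = f (g x)"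
proof -
  have "carrier (homeo_group X) \<subseteq> Bij (topspace X)"
    using subgroup.subset[OF subgroup_homeo[of X]] by (simp add: homeo_group_def BijGroup_def)
  then have "f \<in> Bij (topspace X)" "g \<in> Bij (topspace X)" using assms by auto
  then show ?thesis using assms(3) by (simp add: homeo_group_def BijGroup_def compose_def)
qed

lemma one_homeo_group: "x \<in> topspace X \<Longrightarrow> \<one>\<^bsub>homeo_group X\<^esub> x = x"
  by (simp add: homeo_group_def BijGroup_def)

lemma homeo_group_continuous: "f \<in> carrier (homeo_group X) \<Longrightarrow> continuous_map X X f"
  by (simp add: homeo_group_def homeomorphic_imp_continuous_map)

lemma continuous_discrete_binop:
  assumes "continuous_map X (discrete_topology UNIV) m" "continuous_map X (discrete_topology UNIV) n"
  shows "continuous_map X (discrete_topology UNIV) (\<lambda>x. h (m x) (n x))"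
proof -
  have op: "openin X {x \<in> topspace X. m x = a}" "openin X {x \<in> topspace X. n x = b}" for a b
    using openin_continuous_map_preimage[OF assms(1), of "{a}"]
      openin_continuous_map_preimage[OF assms(2), of "{b}"] by simp_all
  have "openin X {x \<in> topspace X. h (m x) (n x) \<in> U}" for U
  proof -
    have "{x \<in> topspace X. h (m x) (n x) \<in> U} = (\<Union>(a, b) \<in> {(a, b). h a b \<in> U}.
        {x \<in> topspace X. m x = a} \<inter> {x \<in> topspace X. n x = b})"
      by auto
    then show ?thesis using op by (auto intro!: openin_Union)
  qed
  then show ?thesis by (simp add: continuous_map_def)
qed

lemma subgroup_topological_full_group:
  assumes T: "T \<in> carrier (homeo_group X)"
  shows "subgroup (carrier (topological_full_group X T)) (homeo_group X)"
proof -
  interpret G: group "homeo_group X" by (rule group_homeo_group)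
  have pow: "T [^]\<^bsub>homeo_group X\<^esub> (i :: int) \<in> carrier (homeo_group X)" for i
    using T by simp
  have pow_add: "(T [^]\<^bsub>homeo_group X\<^esub> (i + j)) x = (T [^]\<^bsub>homeo_group X\<^esub> i) ((T [^]\<^bsub>homeo_group X\<^esub> j) x)"
    if "x \<in> topspace X" for i j :: int and x
    using homeo_group_simps[OF pow[of i] pow[of j] that] by (simp add: G.int_pow_mult[OF T])
  show ?thesis
  proof (rule G.subgroupI)
    show "carrier (topological_full_group X T) \<subseteq> carrier (homeo_group X)"
      by (auto simp: topological_full_group_def)
    have "\<one>\<^bsub>homeo_group X\<^esub> \<in> carrier (topological_full_group X T)"
      by (auto simp: topological_full_group_def intro!: exI[of _ "\<lambda>_. 0"])
    then show "carrier (topological_full_group X T) \<noteq> {}" by blast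
  next
    fix S assume "S \<in> carrier (topological_full_group X T)"
    then obtain m :: "'a \<Rightarrow> int" where S: "S \<in> carrier (homeo_group X)"
      and m: "continuous_map X (discrete_topology UNIV) m"
      and Sm: "\<And>x. x \<in> topspace X \<Longrightarrow> S x = (T [^]\<^bsub>homeo_group X\<^esub> m x) x"
      by (auto simp: topological_full_group_def)
    define R where "R = inv\<^bsub>homeo_group X\<^esub> S"
    have R: "R \<in> carrier (homeo_group X)" using S by (simp add: R_def)
    have "R x = (T [^]\<^bsub>homeo_group X\<^esub> (- m (R x))) x" if x: "x \<in> topspace X" for x
    proof -
      have Rx: "R x \<in> topspace X"
        using homeo_group_continuous[OF R] x by (auto simp: continuous_map_def)
      have "S (R x) = x"
        using homeo_group_simps[OF S R x] S x by (simp add: R_def one_homeo_group)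
      then have "(T [^]\<^bsub>homeo_group X\<^esub> (- m (R x))) x
          = (T [^]\<^bsub>homeo_group X\<^esub> (- m (R x))) ((T [^]\<^bsub>homeo_group X\<^esub> m (R x)) (R x))"
        using Sm[OF Rx] by simp
      also have "\<dots> = R x"
        using pow_add[OF Rx, of "- m (R x)" "m (R x)"] Rx by (simp add: one_homeo_group)
      finally show ?thesis by simp
    qed
    moreover have "continuous_map X (discrete_topology UNIV) (\<lambda>x. - m (R x))"
      using continuous_discrete_binop[of X "m \<circ> R" "m \<circ> R" "\<lambda>a b. - a"]
        continuous_map_compose[OF homeo_group_continuous[OF R] m] by simp
    ultimately show "inv\<^bsub>homeo_group X\<^esub> S \<in> carrier (topological_full_group X T)"
      unfolding R_def[symmetric] using R
      by (auto simp: topological_full_group_def intro!: exI[of _ "\<lambda>x. - m (R x)"])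
  next
    fix S R assume "S \<in> carrier (topological_full_group X T)"
      "R \<in> carrier (topological_full_group X T)"
    then obtain m n :: "'a \<Rightarrow> int" where S: "S \<in> carrier (homeo_group X)"
      and R: "R \<in> carrier (homeo_group X)"
      and m: "continuous_map X (discrete_topology UNIV) m"
      and n: "continuous_map X (discrete_topology UNIV) n"
      and Sm: "\<And>x. x \<in> topspace X \<Longrightarrow> S x = (T [^]\<^bsub>homeo_group X\<^esub> m x) x"
      and Rn: "\<And>x. x \<in> topspace X \<Longrightarrow> R x = (T [^]\<^bsub>homeo_group X\<^esub> n x) x"
      by (auto simp: topological_full_group_def)
    have "continuous_map X (discrete_topology UNIV) (\<lambda>x. m (R x) + n x)"
      using continuous_discrete_binop[of X "m \<circ> R" n "(+)"] n
        continuous_map_compose[OF homeo_group_continuous[OF R] m] by simp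
    moreover have "(S \<otimes>\<^bsub>homeo_group X\<^esub> R) x = (T [^]\<^bsub>homeo_group X\<^esub> (m (R x) + n x)) x"
      if x: "x \<in> topspace X" for x
    proof -
      have "R x \<in> topspace X"
        using homeo_group_continuous[OF R] x by (auto simp: continuous_map_def)
      then show ?thesis
        using Sm[of "R x"] Rn[OF x] pow_add[OF x] homeo_group_simps[OF S R x] by simp
    qed
    ultimately show "S \<otimes>\<^bsub>homeo_group X\<^esub> R \<in> carrier (topological_full_group X T)"
      using S R by (auto simp: topological_full_group_def intro!: exI[of _ "\<lambda>x. m (R x) + n x"])
  qed
qed

lemma group_topological_full_group:
  assumes "T \<in> carrier (homeo_group X)"
  shows "group (topological_full_group X T)"
  using subgroup.subgroup_is_group[OF subgroup_topological_full_group[OF assms] group_homeo_group]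
  by (simp add: topological_full_group_def)

section \<open>The subshift of the substitution\<close>

datatype letter = La | Lx | Ly | Lz

primrec tau_letter :: "letter \<Rightarrow> letter list" where
  "tau_letter La = [La, Lx, La]"
| "tau_letter Lx = [Ly]"
| "tau_letter Ly = [Lz]"
| "tau_letter Lz = [Lx]"

definition tau :: "letter list \<Rightarrow> letter list" where
  "tau w = concat (map tau_letter w)"

definition Sub_tau :: "letter list set" where
  "Sub_tau = {u. \<exists>n s. sublist u ((tau ^^ n) [s])}"

text \<open>For \<open>j < i\<close> the list \<open>[i..j]\<close> is empty, which accounts for the empty subword.\<close>

definition Omega_tau :: "(int \<Rightarrow> letter) set" where
  "Omega_tau = {\<omega>. \<forall>i j. map \<omega> [i..j] \<in> Sub_tau}"

definition Omega_top :: "(int \<Rightarrow> letter) topology" where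
  "Omega_top = subtopology (product_topology (\<lambda>_. discrete_topology UNIV) UNIV) Omega_tau"

definition shift :: "(int \<Rightarrow> letter) \<Rightarrow> (int \<Rightarrow> letter)" where
  "shift = (\<lambda>\<omega>\<in>Omega_tau. \<lambda>n. \<omega> (n + 1))"

lemma topspace_Omega_top [simp]: "topspace Omega_top = Omega_tau"
  by (simp add: Omega_top_def)

lemma translate_Omega_tau: "\<omega> \<in> Omega_tau \<Longrightarrow> (\<lambda>n. \<omega> (n + k)) \<in> Omega_tau"
proof -
  assume \<omega>: "\<omega> \<in> Omega_tau"
  have "map (\<lambda>n. \<omega> (n + k)) [i..j] = map \<omega> [i + k..j + k]" for i j
    by (rule nth_equalityI) (auto simp: algebra_simps)
  with \<omega> show ?thesis by (simp add: Omega_tau_def)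
qed

lemma homeomorphic_translate: "homeomorphic_map Omega_top Omega_top (\<lambda>\<omega> n. \<omega> (n + k))"
proof -
  have c: "continuous_map Omega_top Omega_top (\<lambda>\<omega> n. \<omega> (n + k))" for k
    unfolding Omega_top_def continuous_map_in_subtopology
  proof
    show "continuous_map (subtopology (product_topology (\<lambda>_. discrete_topology UNIV) UNIV) Omega_tau)
       (product_topology (\<lambda>_. discrete_topology UNIV) UNIV) (\<lambda>(\<omega> :: int \<Rightarrow> letter) n. \<omega> (n + k))"
      by (auto simp: continuous_map_componentwise_UNIV
          intro!: continuous_map_from_subtopology continuous_map_product_projection)
  qed (auto simp: translate_Omega_tau)
  have "homeomorphic_maps Omega_top Omega_top (\<lambda>\<omega> n. \<omega> (n + k)) (\<lambda>\<omega> n. \<omega> (n + - k))"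
    unfolding homeomorphic_maps_def using c[of k] c[of "- k"] by simp
  then show ?thesis using homeomorphic_map_maps by blast
qed

lemma shift_in_homeo_group: "shift \<in> carrier (homeo_group Omega_top)"
  using homeomorphic_map_eq[OF homeomorphic_translate[of 1], of shift]
  by (simp add: homeo_group_def shift_def)

lemma shift_int_pow:
  fixes k :: int
  assumes "\<omega> \<in> Omega_tau"
  shows "(shift [^]\<^bsub>homeo_group Omega_top\<^esub> k) \<omega> = (\<lambda>n. \<omega> (n + k))"
proof -
  interpret G: group "homeo_group Omega_top" by (rule group_homeo_group)
  have pow: "shift [^]\<^bsub>homeo_group Omega_top\<^esub> (i :: int) \<in> carrier (homeo_group Omega_top)" for i
    using shift_in_homeo_group by simp
  have step: "(shift [^]\<^bsub>homeo_group Omega_top\<^esub> (i + 1)) v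
      = (shift [^]\<^bsub>homeo_group Omega_top\<^esub> i) (\<lambda>n. v (n + 1))"
    if "v \<in> Omega_tau" for i :: int and v
    using that homeo_group_simps[OF pow[of i] shift_in_homeo_group, of v] shift_in_homeo_group
    by (simp add: G.int_pow_mult shift_def)
  show ?thesis using assms
  proof (induction k arbitrary: \<omega> rule: int_induct[of _ 0])
    case base then show ?case by (simp add: one_homeo_group)
  next
    case (step1 i)
    then show ?case
      using step[of \<omega> i] translate_Omega_tau[of \<omega> 1]
      by (simp add: add.assoc add.commute[of 1])
  next
    case (step2 i)
    have "(\<lambda>n. \<omega> (n + - 1)) \<in> Omega_tau" using step2.prems by (rule translate_Omega_tau)
    then show ?case
      using step[of "\<lambda>n. \<omega> (n + - 1)" "i - 1"] step2.IH[of "\<lambda>n. \<omega> (n + - 1)"]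
      by (simp add: algebra_simps)
  qed
qed

end

theory Submission
  imports Defs
begin

text \<open>The Schreier graph of the orbit of the ray \<open>111\<dots>\<close> is a half-line. Label an edge of it by
  \<open>a\<close>, or by \<open>x\<close>, \<open>y\<close>, \<open>z\<close> if it is moved by \<open>{b, c}\<close>, \<open>{b, d}\<close>, \<open>{c, d}\<close> respectively. The label of
  the \<open>p\<close>-th edge then depends only on the 2-adic valuation of \<open>p\<close>, and the resulting Toeplitz sequence
  is the limit of the words \<open>\<tau>\<^sup>n(a)\<close>. Let every generator act on \<open>\<Omega>\<^sub>\<tau>\<close> by moving the
  origin across whichever adjacent edge carries one of its labels. If a word in the
  generators acts trivially on the tree, then it fixes every vertex of the half-line, hence every point
  of \<open>\<Omega>\<^sub>\<tau>\<close>, whose finite blocks all occur in the half-line. Conversely, folding the line \<open>\<int>\<close> at the origin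
  gives an equivariant map from a two-sided aperiodic point of \<open>\<Omega>\<^sub>\<tau>\<close> onto every level of the tree,
  so a word acting trivially on \<open>\<Omega>\<^sub>\<tau>\<close> acts trivially on the tree.\<close>

section \<open>Groups generated by involutions\<close>

definition word_prod :: "('a, 'm) monoid_scheme \<Rightarrow> ('i \<Rightarrow> 'a) \<Rightarrow> 'i list \<Rightarrow> 'a" where
  "word_prod G s w = foldr (\<lambda>i x. s i \<otimes>\<^bsub>G\<^esub> x) w \<one>\<^bsub>G\<^esub>"

lemma word_prod_simps [simp]:
  "word_prod G s [] = \<one>\<^bsub>G\<^esub>"
  "word_prod G s (i # w) = s i \<otimes>\<^bsub>G\<^esub> word_prod G s w"
  by (simp_all add: word_prod_def)

context group
begin

lemma word_prod_closed [simp]: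
  "(\<And>i. s i \<in> carrier G) \<Longrightarrow> word_prod G s w \<in> carrier G"
  by (induction w) auto

lemma word_prod_append:
  "(\<And>i. s i \<in> carrier G) \<Longrightarrow> word_prod G s (u @ v) = word_prod G s u \<otimes> word_prod G s v"
  by (induction u) (auto simp: m_assoc)

lemma word_prod_rev:
  assumes "\<And>i. s i \<in> carrier G" "\<And>i. s i \<otimes> s i = \<one>"
  shows "word_prod G s (rev w) = inv (word_prod G s w)"
proof (induction w)
  case (Cons i w)
  then show ?case
    using assms inv_equality[of "s i" "s i"] by (simp add: word_prod_append inv_mult_group)
qed simp

text \<open>Each generator is its own inverse, so words without formal inverses already exhaust the
  generated subgroup.\<close>

lemma generate_involutions:
  assumes s: "\<And>i. s i \<in> carrier G" and invol: "\<And>i. s i \<otimes> s i = \<one>"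
  shows "generate G (range s) = range (word_prod G s)"
proof
  show "generate G (range s) \<subseteq> range (word_prod G s)"
  proof
    fix g assume "g \<in> generate G (range s)"
    then show "g \<in> range (word_prod G s)"
    proof induction
      case one
      then show ?case by (metis rangeI word_prod_simps(1))
    next
      case (incl h)
      then obtain i where "h = s i" by auto
      then have "h = word_prod G s [i]" using s by simp
      then show ?case by blast
    next
      case (inv h)
      then obtain i where "h = s i" by auto
      then have "inv h = word_prod G s [i]"
        using s invol inv_equality[of "s i" "s i"] by simp
      then show ?case by (metis rangeI)
    next
      case (eng h1 h2)
      then obtain u v where "h1 = word_prod G s u" "h2 = word_prod G s v" by auto
      then have "h1 \<otimes> h2 = word_prod G s (u @ v)" using s by (simp add: word_prod_append)
      then show ?case by (metis rangeI)
    qed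
  qed
  have "word_prod G s w \<in> generate G (range s)" for w
    by (induction w) (auto intro: generate.intros)
  then show "range (word_prod G s) \<subseteq> generate G (range s)" by auto
qed

lemma word_prod_eq_iff:
  assumes s: "\<And>i. s i \<in> carrier G" and invol: "\<And>i. s i \<otimes> s i = \<one>"
  shows "word_prod G s u = word_prod G s v \<longleftrightarrow> word_prod G s (u @ rev v) = \<one>"
proof -
  have cl: "word_prod G s w \<in> carrier G" for w using s by simp
  show ?thesis
    using cl[of u] cl[of v] inv_equality[of "word_prod G s u" "inv (word_prod G s v)"] r_inv[of "word_prod G s v"]
    by (auto simp: word_prod_append word_prod_rev s invol)
qed

end

text \<open>Two words have equal values exactly when \<open>u @ rev v\<close> is a relator. With the
  same relators on both sides, sending the value of a word in \<open>G\<close> to its value in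
  \<open>H\<close> is well defined and injective, so the embedding reduces to a comparison of
  relators.\<close>

lemma generate_iso_of_same_relators:
  assumes "group G" and "group H"
    and s: "\<And>i. s i \<in> carrier G" "\<And>i. s i \<otimes>\<^bsub>G\<^esub> s i = \<one>\<^bsub>G\<^esub>"
    and t: "\<And>i. t i \<in> carrier H" "\<And>i. t i \<otimes>\<^bsub>H\<^esub> t i = \<one>\<^bsub>H\<^esub>"
    and rel: "\<And>w. word_prod G s w = \<one>\<^bsub>G\<^esub> \<longleftrightarrow> word_prod H t w = \<one>\<^bsub>H\<^esub>"
  shows "G\<lparr>carrier := generate G (range s)\<rparr> \<cong> H\<lparr>carrier := generate H (range t)\<rparr>"
proof -
  interpret G: group G by fact
  interpret H: group H by fact
  have genG: "generate G (range s) = range (word_prod G s)"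
    and genH: "generate H (range t) = range (word_prod H t)"
    using G.generate_involutions[of s, OF s] H.generate_involutions[of t, OF t] by simp_all
  have eq: "word_prod G s u = word_prod G s v \<longleftrightarrow> word_prod H t u = word_prod H t v" for u v
    using G.word_prod_eq_iff[of s u v, OF s] H.word_prod_eq_iff[of t u v, OF t] rel by simp
  \<comment> \<open>The chosen word is arbitrary; \<open>eq\<close> makes the value independent of
    the choice.\<close>
  define f where "f g = word_prod H t (SOME w. word_prod G s w = g)" for g
  have f: "f (word_prod G s w) = word_prod H t w" for w
    unfolding f_def using eq by (metis (mono_tags) someI)
  have "f \<in> iso (G\<lparr>carrier := range (word_prod G s)\<rparr>) (H\<lparr>carrier := range (word_prod H t)\<rparr>)"
  proof (rule isoI)
    show "f \<in> hom (G\<lparr>carrier := range (word_prod G s)\<rparr>) (H\<lparr>carrier := range (word_prod H t)\<rparr>)"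
    proof (rule homI)
      fix x y
      assume "x \<in> carrier (G\<lparr>carrier := range (word_prod G s)\<rparr>)"
        "y \<in> carrier (G\<lparr>carrier := range (word_prod G s)\<rparr>)"
      then obtain u v where uv: "x = word_prod G s u" "y = word_prod G s v" by auto
      show "f (x \<otimes>\<^bsub>G\<lparr>carrier := range (word_prod G s)\<rparr>\<^esub> y) =
          f x \<otimes>\<^bsub>H\<lparr>carrier := range (word_prod H t)\<rparr>\<^esub> f y"
        using f[of "u @ v"] s t by (simp add: uv f G.word_prod_append H.word_prod_append)
    qed (auto simp: f)
    have "bij_betw f (range (word_prod G s)) (range (word_prod H t))"
      unfolding bij_betw_def inj_on_def by (auto simp: f eq image_iff)
    then show "bij_betw f (carrier (G\<lparr>carrier := range (word_prod G s)\<rparr>))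
        (carrier (H\<lparr>carrier := range (word_prod H t)\<rparr>))"
      by simp
  qed
  then show ?thesis unfolding is_iso_def genG genH by blast
qed

section \<open>The Toeplitz sequence of the substitution\<close>

text \<open>On \<open>Lx\<close>, \<open>Ly\<close>, \<open>Lz\<close> this is the substitution;
  \<open>La\<close> goes to \<open>Lx\<close> so that iteration from \<open>La\<close> lists the
  letters of 2-adic valuation 0, 1, 2, and so on.\<close>

fun next_letter :: "letter \<Rightarrow> letter" where
  "next_letter La = Lx"
| "next_letter Lx = Ly"
| "next_letter Ly = Lz"
| "next_letter Lz = Lx"

lemma next_letter_neq [simp]: "next_letter l \<noteq> La" "next_letter l \<noteq> l"
  by (cases l; simp)+

text \<open>The value at \<open>0\<close> is a choice: any letter other than \<open>La\<close> gives a point of \<open>Omega_tau\<close>.\<close>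

function toeplitz :: "int \<Rightarrow> letter" where
  "toeplitz p = (if p = 0 then Lx else if odd p then La else next_letter (toeplitz (p div 2)))"
  by auto
termination by (relation "measure (\<lambda>p. nat \<bar>p\<bar>)") auto

declare toeplitz.simps [simp del]

lemma toeplitz_0 [simp]: "toeplitz 0 = Lx"
  and toeplitz_odd: "odd p \<Longrightarrow> toeplitz p = La"
  and toeplitz_double: "p \<noteq> 0 \<Longrightarrow> toeplitz (2 * p) = next_letter (toeplitz p)"
  by (subst toeplitz.simps; auto)+

lemma toeplitz_eq_La_iff: "toeplitz p = La \<longleftrightarrow> odd p"
  by (subst toeplitz.simps) auto

lemma toeplitz_power2: "toeplitz (2 ^ m) = (next_letter ^^ m) La"
  by (induction m) (simp_all add: toeplitz_odd toeplitz_double)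

text \<open>Adding a multiple of \<open>2 ^ m\<close> preserves every 2-adic valuation below
  \<open>m\<close>. Halving an even position lowers \<open>m\<close> by one.\<close>

lemma toeplitz_periodic:
  "\<not> 2 ^ m dvd j \<Longrightarrow> toeplitz (j + 2 ^ m * t) = toeplitz j"
proof (induction m arbitrary: j)
  case (Suc m)
  show ?case
  proof (cases "odd j")
    case True
    then show ?thesis by (simp add: toeplitz_odd)
  next
    case False
    then obtain i where j: "j = 2 * i" by blast
    then have i: "\<not> 2 ^ m dvd i" using Suc.prems by simp
    have "i + 2 ^ m * t \<noteq> 0"
    proof
      assume "i + 2 ^ m * t = 0"
      then have "i = 2 ^ m * (- t)" by simp
      with i show False by (metis dvd_triv_left)
    qed
    moreover have "i \<noteq> 0" using i by auto
    moreover have "j + 2 ^ Suc m * t = 2 * (i + 2 ^ m * t)" by (simp add: j)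
    ultimately show ?thesis using Suc.IH[OF i] j by (simp add: toeplitz_double del: distrib_left_numeral)
  qed
qed simp

lemma not_power2_dvd: "j \<noteq> 0 \<Longrightarrow> \<bar>j\<bar> < 2 ^ m \<Longrightarrow> \<not> 2 ^ m dvd (j :: int)"
  by (auto dest: dvd_imp_le_int)

lemma toeplitz_add_power2:
  "j \<noteq> 0 \<Longrightarrow> \<bar>j\<bar> < 2 ^ m \<Longrightarrow> toeplitz (j + 2 ^ m) = toeplitz j"
  using toeplitz_periodic[OF not_power2_dvd, of j m 1] by simp

lemma abs_less_power2: "\<exists>m. \<bar>j :: int\<bar> < 2 ^ m"
proof
  have "int (nat \<bar>j\<bar>) < int (2 ^ nat \<bar>j\<bar>)" by (simp only: of_nat_less_iff less_exp)
  then show "\<bar>j\<bar> < 2 ^ nat \<bar>j\<bar>" by simp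
qed

text \<open>Far powers of 2 do not affect the valuation of \<open>k\<close>, so a nonzero period
  \<open>k\<close> would give \<open>2 ^ m\<close> and \<open>2 ^ Suc m\<close> the same letter as
  \<open>k\<close>; but their letters are consecutive under \<open>next_letter\<close>.\<close>

lemma toeplitz_aperiodic:
  assumes per: "\<And>n. toeplitz (n + k) = toeplitz n"
  shows "k = 0"
proof (rule ccontr)
  assume k: "k \<noteq> 0"
  obtain m where m: "\<bar>k\<bar> < 2 ^ m" using abs_less_power2 by blast
  have "toeplitz (2 ^ m) = toeplitz k"
    using per[of "2 ^ m"] toeplitz_add_power2[OF k m] by (simp add: add.commute)
  moreover have "toeplitz (2 ^ Suc m) = toeplitz k"
    using per[of "2 ^ Suc m"] toeplitz_add_power2[OF k, of "Suc m"] m by (simp add: add.commute)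
  ultimately have "next_letter (toeplitz k) = toeplitz k"
    unfolding toeplitz_power2 by simp
  then show False by simp
qed

section \<open>The subshift as the set of limits of the Toeplitz sequence\<close>

lemma tau_append: "tau (u @ v) = tau u @ tau v"
  by (simp add: tau_def)

lemma tau_power_append: "(tau ^^ n) (u @ v) = (tau ^^ n) u @ (tau ^^ n) v"
  by (induction n) (simp_all add: tau_append)

lemma tau_power_singleton: "l \<noteq> La \<Longrightarrow> (tau ^^ n) [l] = [(next_letter ^^ n) l] \<and> (next_letter ^^ n) l \<noteq> La"
proof (induction n)
  case (Suc n)
  moreover have "l \<noteq> La \<Longrightarrow> tau [l] = [next_letter l]" for l by (cases l) (simp_all add: tau_def)
  ultimately show ?case by simp
qed simp

lemma map_upto_translate: "map f [i + k..j + k] = map (\<lambda>n. f (n + k)) [i..j :: int]"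
  by (rule nth_equalityI) (auto simp: algebra_simps)

text \<open>Each new word is two copies of the previous one around a single letter. That letter
  falls at position \<open>2 ^ Suc n\<close>, and translation by this number carries the left copy
  onto the right one.\<close>

lemma tau_power_La: "(tau ^^ n) [La] = map toeplitz [1..2 ^ Suc n - 1]"
proof (induction n)
  case 0
  show ?case by (simp add: toeplitz_odd)
next
  case (Suc n)
  let ?N = "2 ^ Suc n :: int"
  have "(tau ^^ Suc n) [La] = (tau ^^ n) ([La] @ [Lx] @ [La])"
    by (simp add: funpow_Suc_right tau_def del: funpow.simps)
  also have "\<dots> = map toeplitz [1..?N - 1] @ [toeplitz ?N] @ map toeplitz [1..?N - 1]"
    using tau_power_singleton[of Lx n] unfolding toeplitz_power2
    by (simp only: tau_power_append Suc.IH) (simp add: funpow_Suc_right del: funpow.simps)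
  also have "\<dots> = map toeplitz [1..?N - 1] @ [toeplitz ?N] @ map toeplitz [1 + ?N..?N - 1 + ?N]"
    unfolding map_upto_translate by (auto simp: toeplitz_add_power2 simp del: power_Suc)
  also have "\<dots> = map toeplitz ([1..?N - 1] @ [?N..2 ^ Suc (Suc n) - 1])"
    using upto_rec1[of ?N "2 ^ Suc (Suc n) - 1"] by (simp add: add.commute)
  also have "[1..?N - 1] @ [?N..2 ^ Suc (Suc n) - 1] = [1..2 ^ Suc (Suc n) - 1]"
    using one_le_power[of "2 :: int" "Suc n"] one_le_power[of "2 :: int" "Suc (Suc n)"]
    by (intro upto_split1[symmetric]) auto
  finally show ?case .
qed

lemma Sub_tau_toeplitz_window:
  assumes "1 \<le> i"
  shows "map toeplitz [i..j] \<in> Sub_tau"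
proof (cases "i \<le> j")
  case True
  obtain m where m: "\<bar>j\<bar> < 2 ^ m" using abs_less_power2 by blast
  then have m': "j \<le> 2 ^ Suc m - 1" by simp
  have "[1..2 ^ Suc m - 1] = [1..i - 1] @ [i..j] @ [j + 1..2 ^ Suc m - 1]"
    using assms True m' upto_split1[of 1 i "2 ^ Suc m - 1"] upto_split2[of i j "2 ^ Suc m - 1"]
    by (simp del: power_Suc)
  then have "sublist (map toeplitz [i..j]) ((tau ^^ m) [La])"
    unfolding tau_power_La by (metis map_append sublist_appendI)
  then show ?thesis by (auto simp: Sub_tau_def)
next
  case False
  then show ?thesis by (simp add: Sub_tau_def)
qed

lemma Sub_tau_imp_toeplitz_window:
  assumes "u \<in> Sub_tau"
  shows "\<exists>i\<ge>1. \<forall>k < length u. u ! k = toeplitz (i + int k)"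
proof -
  have "\<exists>p\<ge>1. \<forall>k < length ((tau ^^ n) [l]). (tau ^^ n) [l] ! k = toeplitz (p + int k)" for n l
  proof (cases "l = La")
    case True
    then show ?thesis by (auto simp: tau_power_La intro!: exI[of _ 1])
  next
    case False
    \<comment> \<open>A one-letter word needs an occurrence at a positive position; 2, 4 and 8
      supply the three letters.\<close>
    have "toeplitz (2 ^ 1) = Lx" "toeplitz (2 ^ 2) = Ly" "toeplitz (2 ^ 3) = Lz"
      unfolding toeplitz_power2 by (simp_all add: numeral_eq_Suc)
    then have "\<exists>p\<ge>1. toeplitz p = l" if "l \<noteq> La" for l
      using that by (cases l) (metis one_le_numeral one_le_power)+
    then obtain p where "p \<ge> 1" "toeplitz p = (next_letter ^^ n) l"
      using tau_power_singleton[OF False, of n] by blast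
    then show ?thesis using tau_power_singleton[OF False, of n] by auto
  qed
  moreover obtain n l pre suf where "(tau ^^ n) [l] = pre @ u @ suf"
    using assms by (auto simp: Sub_tau_def sublist_def)
  ultimately obtain p where p: "p \<ge> 1"
    "\<And>k. k < length (pre @ u @ suf) \<Longrightarrow> (pre @ u @ suf) ! k = toeplitz (p + int k)"
    by metis
  have "u ! k = toeplitz (p + int (length pre) + int k)" if "k < length u" for k
    using p(2)[of "length pre + k"] that by (simp add: nth_append algebra_simps)
  then show ?thesis using p(1) by (intro exI[of _ "p + int (length pre)"]) auto
qed

text \<open>The bound \<open>p > int K\<close> keeps the whole window at positive edges, that is,
  inside the half-line.\<close>

lemma Omega_tau_window:
  assumes "\<omega> \<in> Omega_tau"
  obtains p where "p > int K" "\<And>i. \<bar>i\<bar> \<le> int K \<Longrightarrow> \<omega> i = toeplitz (i + p)"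
proof -
  have "map \<omega> [- int K..int K] \<in> Sub_tau" using assms by (simp add: Omega_tau_def)
  then obtain q where q: "q \<ge> 1" "\<And>k. k < 2 * K + 1 \<Longrightarrow> \<omega> (- int K + int k) = toeplitz (q + int k)"
    using Sub_tau_imp_toeplitz_window[of "map \<omega> [- int K..int K]"] by auto
  show thesis
  proof (rule that[of "q + int K"])
    show "int K < q + int K" using q(1) by simp
    fix i assume "\<bar>i\<bar> \<le> int K"
    then have "nat (i + int K) < 2 * K + 1" "int (nat (i + int K)) = i + int K" by linarith+
    then show "\<omega> i = toeplitz (i + (q + int K))"
      using q(2)[of "nat (i + int K)"] by (simp add: algebra_simps)
  qed
qed

lemma toeplitz_in_Omega_tau: "toeplitz \<in> Omega_tau"
proof -
  have "map toeplitz [i..j] \<in> Sub_tau" for i j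
  proof -
    have Lx: "(next_letter ^^ (3 * r)) Lx = Lx" for r
      by (induction r) (simp_all add: numeral_eq_Suc)
    obtain r where r: "\<bar>\<bar>i\<bar> + \<bar>j\<bar>\<bar> < (2 :: int) ^ r" using abs_less_power2 by blast
    \<comment> \<open>Translation by \<open>N\<close> makes the window positive. The exponent is 1
      modulo 3 so that position 0, whose letter is \<open>Lx\<close>, lands on an \<open>Lx\<close>;
      the other positions have valuations too small to change.\<close>
    define N where "N = (2 :: int) ^ Suc (3 * r)"
    have "(2 :: int) ^ r \<le> N" unfolding N_def by (rule power_increasing) auto
    then have N: "\<bar>i\<bar> + \<bar>j\<bar> < N" using r by simp
    have "toeplitz k = toeplitz (k + N)" if "k \<in> {i..j}" for k
    proof (cases "k = 0")
      case True
      have "toeplitz N = Lx"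
        unfolding N_def toeplitz_power2 using Lx[of r] by (simp add: funpow_Suc_right del: funpow.simps)
      then show ?thesis using True by simp
    next
      case False
      then show ?thesis
        using toeplitz_add_power2[of k "Suc (3 * r)"] that N by (auto simp: N_def)
    qed
    then have "map toeplitz [i..j] = map toeplitz [i + N..j + N]"
      unfolding map_upto_translate by (intro map_cong) auto
    then show ?thesis using N by (simp add: Sub_tau_toeplitz_window)
  qed
  then show ?thesis by (simp add: Omega_tau_def)
qed

section \<open>Walking along a labelled line\<close>

datatype gen = Ga | Gb | Gc | Gd

fun labels :: "gen \<Rightarrow> letter set" where
  "labels Ga = {La}"
| "labels Gb = {Lx, Ly}"
| "labels Gc = {Lx, Lz}"
| "labels Gd = {Ly, Lz}"

text \<open>The letter \<open>\<omega> p\<close> labels the edge joining the vertices \<open>p\<close> and \<open>p + 1\<close>.\<close>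

definition displacement :: "gen \<Rightarrow> (int \<Rightarrow> letter) \<Rightarrow> int" where
  "displacement s \<omega> =
     (if \<omega> 0 \<in> labels s then 1 else if \<omega> (- 1) \<in> labels s then - 1 else 0)"

definition walk_step :: "(int \<Rightarrow> letter) \<Rightarrow> gen \<Rightarrow> int \<Rightarrow> int" where
  "walk_step \<omega> s p = p + displacement s (\<lambda>n. \<omega> (n + p))"

text \<open>With \<open>foldr\<close> the last generator of the word acts first, as in a composition
  of maps.\<close>

definition walk :: "(int \<Rightarrow> letter) \<Rightarrow> gen list \<Rightarrow> int \<Rightarrow> int" where
  "walk \<omega> = foldr (walk_step \<omega>)"

lemma walk_simps [simp]:
  "walk \<omega> [] p = p" "walk \<omega> (s # w) p = walk_step \<omega> s (walk \<omega> w p)"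
  by (simp_all add: walk_def)

lemma walk_step_altdef:
  "walk_step \<omega> s p =
     (if \<omega> p \<in> labels s then p + 1 else if \<omega> (p - 1) \<in> labels s then p - 1 else p)"
  by (simp add: walk_step_def displacement_def)

text \<open>Of two consecutive letters exactly one is \<open>La\<close>, and no label set contains
  \<open>La\<close> together with another letter. Hence a generator has at most one edge to cross at
  each vertex.\<close>

lemma labels_adjacent:
  assumes "\<omega> \<in> Omega_tau" "\<omega> p \<in> labels s"
  shows "\<omega> (p - 1) \<notin> labels s" "\<omega> (p + 1) \<notin> labels s"
proof -
  obtain q where "\<And>i. \<bar>i\<bar> \<le> int (nat (\<bar>p\<bar> + 1)) \<Longrightarrow> \<omega> i = toeplitz (i + q)"
    using Omega_tau_window[OF assms(1)] by blast
  then have "\<omega> p = La \<longleftrightarrow> odd (p + q)" "\<omega> (p - 1) = La \<longleftrightarrow> even (p + q)"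
    "\<omega> (p + 1) = La \<longleftrightarrow> even (p + q)"
    by (simp_all add: toeplitz_eq_La_iff)
  then show "\<omega> (p - 1) \<notin> labels s" "\<omega> (p + 1) \<notin> labels s"
    using assms(2) by (cases s; auto)+
qed

lemma walk_step_involution:
  "\<omega> \<in> Omega_tau \<Longrightarrow> walk_step \<omega> s (walk_step \<omega> s p) = p"
  using labels_adjacent[of \<omega> p s] labels_adjacent[of \<omega> "p - 1" s]
  by (auto simp: walk_step_altdef)

lemma walk_dist: "\<bar>walk \<omega> w p - p\<bar> \<le> int (length w)"
  by (induction w) (auto simp: walk_step_altdef)

text \<open>By \<open>walk_dist\<close> the walk reads only letters within distance
  \<open>length w\<close> of its start.\<close>

lemma walk_local:
  assumes "\<And>i. \<bar>i\<bar> \<le> int (length w) \<Longrightarrow> \<omega> i = \<omega>' (i + p)"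
  shows "walk \<omega>' w p = walk \<omega> w 0 + p"
  using assms
proof (induction w)
  case (Cons s w)
  have "\<bar>walk \<omega> w 0\<bar> \<le> int (length w)" using walk_dist[of \<omega> w 0] by simp
  then show ?case
    using Cons.IH Cons.prems Cons.prems[of "walk \<omega> w 0"] Cons.prems[of "walk \<omega> w 0 - 1"]
    by (simp add: walk_step_altdef algebra_simps)
qed simp

section \<open>The orbit of the rightmost ray as a Toeplitz-labelled line\<close>

fun grig :: "gen \<Rightarrow> bin list \<Rightarrow> bin list" where
  "grig Ga = grig_a"
| "grig Gb = grig_b"
| "grig Gc = grig_c"
| "grig Gd = grig_d"

lemma range_grig: "range grig = {grig_a, grig_b, grig_c, grig_d}"
proof -
  have "(UNIV :: gen set) = {Ga, Gb, Gc, Gd}" using gen.exhaust by blast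
  then have "range grig = grig ` {Ga, Gb, Gc, Gd}" by (rule arg_cong)
  then show ?thesis by simp
qed

text \<open>A reflected Gray code: the edges of level \<open>n + 1\<close> moved by \<open>grig_a\<close> only change the first
  digit, and the others lie over the edges of level \<open>n\<close>. The vertices \<open>p\<close> and \<open>1 - p\<close> have the same
  address; they are identified by folding \<open>\<int>\<close> along the edge \<open>0\<close>.\<close>

primrec address :: "nat \<Rightarrow> int \<Rightarrow> bin list" where
  "address 0 p = []"
| "address (Suc n) p = (if p mod 4 \<in> {2, 3} then B0 else B1) # address n ((p + 1) div 2)"

text \<open>Both ends of edge 0 have an address consisting of \<open>B1\<close> only, so crossing
  that edge is invisible on the tree.\<close>

lemma address_0: "address n 0 = address n 1"
  by (induction n) simp_all

lemma address_Suc: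
  "address (Suc n) (4 * k) = B1 # address n (2 * k)"
  "address (Suc n) (4 * k + 1) = B1 # address n (2 * k + 1)"
  "address (Suc n) (4 * k + 2) = B0 # address n (2 * k + 1)"
  "address (Suc n) (4 * k + 3) = B0 # address n (2 * k + 2)"
  "address (Suc n) (4 * k + 4) = B1 # address n (2 * k + 2)"
  "address (Suc n) (4 * k - 1) = B0 # address n (2 * k)"
proof -
  have mod: "(4 * k) mod 4 = 0" "(4 * k + 1) mod 4 = 1" "(4 * k + 2) mod 4 = 2"
    "(4 * k + 3) mod 4 = 3" "(4 * k + 4) mod 4 = 0" "(4 * k - 1) mod 4 = 3"
    by presburger+
  have div: "(4 * k + 1) div 2 = 2 * k" "(4 * k + 1 + 1) div 2 = 2 * k + 1"
    "(4 * k + 2 + 1) div 2 = 2 * k + 1" "(4 * k + 3 + 1) div 2 = 2 * k + 2"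
    "(4 * k + 4 + 1) div 2 = 2 * k + 2" "(4 * k - 1 + 1) div 2 = 2 * k"
    by presburger+
  show "address (Suc n) (4 * k) = B1 # address n (2 * k)"
    "address (Suc n) (4 * k + 1) = B1 # address n (2 * k + 1)"
    "address (Suc n) (4 * k + 2) = B0 # address n (2 * k + 1)"
    "address (Suc n) (4 * k + 3) = B0 # address n (2 * k + 2)"
    "address (Suc n) (4 * k + 4) = B1 # address n (2 * k + 2)"
    "address (Suc n) (4 * k - 1) = B0 # address n (2 * k)"
    unfolding address.simps mod div by simp_all
qed

text \<open>Odd edges, labelled \<open>La\<close>, flip the first digit. Edge
  \<open>4 * k + 2\<close> lies below \<open>B0\<close> over an \<open>La\<close> edge and is
  labelled \<open>Lx\<close>, matching the \<open>grig_a\<close> in \<open>grig_b\<close> and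
  \<open>grig_c\<close>. Edge \<open>4 * k\<close> lies below \<open>B1\<close> over edge
  \<open>2 * k\<close>, and \<open>next_letter\<close> maps the labels of \<open>Gc\<close>,
  \<open>Gd\<close>, \<open>Gb\<close> to those of \<open>Gb\<close>, \<open>Gc\<close>,
  \<open>Gd\<close>, matching the recursion there.\<close>

lemma grig_address: "grig s (address n p) = address n (walk_step toeplitz s p)"
proof (induction n arbitrary: s p)
  case 0
  then show ?case by (cases s) simp_all
next
  case (Suc n)
  define k where "k = p div 4"
  have "p mod 4 = 0 \<or> p mod 4 = 1 \<or> p mod 4 = 2 \<or> p mod 4 = 3" by presburger
  then consider (r0) "p = 4 * k" | (r1) "p = 4 * k + 1" | (r2) "p = 4 * k + 2" | (r3) "p = 4 * k + 3"
    using mult_div_mod_eq[of 4 p] unfolding k_def by fastforce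
  note residue = this
  have odd: "toeplitz (2 * k + 1) = La" "toeplitz (2 * k - 1) = La"
    "toeplitz (4 * k + 1) = La" "toeplitz (4 * k + 3) = La" "toeplitz (4 * k - 1) = La"
    by (simp_all add: toeplitz_eq_La_iff)
  have "2 * k + 1 \<noteq> 0" by presburger
  then have two: "toeplitz (4 * k + 2) = Lx"
    using toeplitz_double[of "2 * k + 1"] odd(1) by (simp add: algebra_simps)
  have even: "toeplitz (2 * k) \<noteq> La" "toeplitz (2 * k + 2) \<noteq> La"
    by (simp_all add: toeplitz_eq_La_iff)
  have four: "toeplitz (4 * k) = next_letter (toeplitz (2 * k))" if "k \<noteq> 0"
    using toeplitz_double[of "2 * k"] that by simp
  have IH: "grig_a (address n q) = address n (walk_step toeplitz Ga q)"
    "grig_b (address n q) = address n (walk_step toeplitz Gb q)"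
    "grig_c (address n q) = address n (walk_step toeplitz Gc q)"
    "grig_d (address n q) = address n (walk_step toeplitz Gd q)" for q
    using Suc.IH[of Ga q] Suc.IH[of Gb q] Suc.IH[of Gc q] Suc.IH[of Gd q] by simp_all
  note comm = add.commute[of 1 "4 * k"] add.commute[of 2 "4 * k"] add.commute[of 3 "4 * k"]
    add.commute[of 4 "4 * k"] add.commute[of 1 "2 * k"] add.commute[of 2 "2 * k"]
  note simps = comm odd two even address_Suc IH walk_step_altdef
  show ?case
  proof (cases "k = 0")
    case True
    have origin: "address (Suc n) 0 = B1 # address n 1" "address (Suc n) 1 = B1 # address n 1"
      "address (Suc n) 2 = B0 # address n 1" "address (Suc n) 3 = B0 # address n 2"
      "address (Suc n) (- 1) = B0 # address n 1" "address (Suc n) 4 = B1 # address n 2"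
      using address_Suc[of n 0] by (simp_all add: address_0)
    show ?thesis
      using residue
    proof cases
      case r0
      then show ?thesis
        using odd two even by (cases s) (simp_all add: True origin IH walk_step_altdef address_0 del: address.simps)
    next
      case r1
      then show ?thesis
        using odd two even by (cases s) (simp_all add: True origin IH walk_step_altdef address_0 del: address.simps)
    next
      case r2
      then show ?thesis
        using odd two even by (cases s) (simp_all add: True origin IH walk_step_altdef address_0 del: address.simps)
    next
      case r3
      then show ?thesis
        using odd two even by (cases s) (simp_all add: True origin IH walk_step_altdef address_0 del: address.simps)
    qed
  next
    case False
    show ?thesis
      using residue
    proof cases
      case r0
      then show ?thesis
        using even(1) by (cases s; cases "toeplitz (2 * k)") (simp_all add: simps four False del: address.simps)
    next
      case r1
      then show ?thesis
        using even(1) by (cases s; cases "toeplitz (2 * k)") (simp_all add: simps four False del: address.simps)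
    next
      case r2
      then show ?thesis
        using even(1) by (cases s; cases "toeplitz (2 * k)") (simp_all add: simps four False del: address.simps)
    next
      case r3
      then show ?thesis
        using even(1) by (cases s; cases "toeplitz (2 * k)") (simp_all add: simps four False del: address.simps)
    qed
  qed
qed

lemma grig_word_address: "foldr grig w (address n p) = address n (walk toeplitz w p)"
  by (induction w) (simp_all add: grig_address)

text \<open>The tail determines \<open>(p + 1) div 2\<close> by induction, and the first digit
  separates the two vertices lying over that one. The range stays on one side of the fold.\<close>

lemma address_inj:
  assumes "address n p = address n q" "1 \<le> p" "p \<le> 2 ^ n" "1 \<le> q" "q \<le> 2 ^ n"
  shows "p = q"
  using assms
proof (induction n arbitrary: p q)
  case (Suc n)
  have "(p + 1) div 2 = (q + 1) div 2"
    using Suc.prems by (intro Suc.IH) auto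
  moreover have "p mod 4 \<in> {2, 3} \<longleftrightarrow> q mod 4 \<in> {2, 3}"
    using Suc.prems(1) by (auto split: if_splits)
  ultimately show ?case unfolding insert_iff empty_iff by presburger
qed simp

lemma address_surj: "\<exists>p. address (length v) p = v"
proof (induction v)
  case (Cons x v)
  then obtain q where q: "address (length v) q = v" by blast
  have "(2 * q - 1 + 1) div 2 = q" "(2 * q + 1) div 2 = q"
    "(2 * q - 1) mod 4 \<in> {2, 3} \<longleftrightarrow> (2 * q) mod 4 \<notin> {2, 3}"
    unfolding insert_iff empty_iff by presburger+
  then have "address (Suc (length v)) (2 * q - 1) = x # v \<or> address (Suc (length v)) (2 * q) = x # v"
    using q by (cases x) (simp_all del: insert_iff)
  then show ?case by auto
qed simp

lemma grig_relator_iff: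
  "(\<forall>v. foldr grig w v = v) \<longleftrightarrow> (\<forall>\<omega>\<in>Omega_tau. \<forall>n. \<omega> (n + walk \<omega> w 0) = \<omega> n)"
proof
  assume tree: "\<forall>v. foldr grig w v = v"
  have "walk \<omega> w 0 = 0" if \<omega>: "\<omega> \<in> Omega_tau" for \<omega>
  proof -
    obtain p where p: "p > int (length w)"
      and win: "\<And>i. \<bar>i\<bar> \<le> int (length w) \<Longrightarrow> \<omega> i = toeplitz (i + p)"
      using Omega_tau_window[OF \<omega>] by blast
    define q where "q = walk toeplitz w p"
    have q: "q = walk \<omega> w 0 + p" "q \<ge> 1"
      unfolding q_def using walk_local[of w \<omega> toeplitz p, OF win] walk_dist[of toeplitz w p] p by simp_all
    \<comment> \<open>Level \<open>n\<close> is deep enough for \<open>p\<close> and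
      \<open>q\<close> to lie in the range where \<open>address\<close> is injective.\<close>
    obtain n where n: "\<bar>p + q\<bar> < 2 ^ n" using abs_less_power2 by blast
    have "address n q = address n p"
      using grig_word_address[of w n p] tree by (simp add: q_def)
    then have "q = p" by (rule address_inj) (use n q p in linarith)+
    then show ?thesis using q by simp
  qed
  then show "\<forall>\<omega>\<in>Omega_tau. \<forall>n. \<omega> (n + walk \<omega> w 0) = \<omega> n" by simp
next
  assume shift: "\<forall>\<omega>\<in>Omega_tau. \<forall>n. \<omega> (n + walk \<omega> w 0) = \<omega> n"
  have walk: "walk toeplitz w p = p" for p
  proof -
    \<comment> \<open>The hypothesis concerns walks from the origin only, so the sequence is
      translated to bring \<open>p\<close> there.\<close>
    define \<omega> where "\<omega> = (\<lambda>n. toeplitz (n + p))"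
    have "\<omega> \<in> Omega_tau"
      unfolding \<omega>_def by (rule translate_Omega_tau[OF toeplitz_in_Omega_tau])
    then have \<omega>: "\<omega> (n + walk \<omega> w 0) = \<omega> n" for n using shift by blast
    have "toeplitz (n + walk \<omega> w 0) = toeplitz n" for n
      using \<omega>[of "n - p"] by (simp add: \<omega>_def algebra_simps)
    then have "walk \<omega> w 0 = 0" by (rule toeplitz_aperiodic)
    then show ?thesis using walk_local[of w \<omega> toeplitz p] by (simp add: \<omega>_def)
  qed
  show "\<forall>v. foldr grig w v = v"
  proof
    fix v
    obtain p where "v = address (length v) p" using address_surj[of v] by metis
    then show "foldr grig w v = v" using grig_word_address[of w "length v" p] walk by simp
  qed
qed

section \<open>The embedding into the topological full group\<close>

definition flow :: "gen \<Rightarrow> (int \<Rightarrow> letter) \<Rightarrow> int \<Rightarrow> letter" where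
  "flow s = (\<lambda>\<omega>\<in>Omega_tau. \<lambda>n. \<omega> (n + displacement s \<omega>))"

text \<open>Within one orbit the flow on points becomes the walk on positions of a fixed line, so
  products of flows reduce to \<open>walk\<close>.\<close>

lemma flow_translate:
  "\<omega> \<in> Omega_tau \<Longrightarrow> flow s (\<lambda>n. \<omega> (n + p)) = (\<lambda>n. \<omega> (n + walk_step \<omega> s p))"
  by (simp add: flow_def translate_Omega_tau walk_step_def algebra_simps)

lemma flow_involution:
  assumes "\<omega> \<in> Omega_tau"
  shows "flow s (flow s \<omega>) = \<omega>"
  using flow_translate[OF assms, of s 0] flow_translate[OF assms, of s "walk_step \<omega> s 0"]
    walk_step_involution[OF assms, of s 0] by simp

lemma continuous_coordinate:
  "continuous_map Omega_top (discrete_topology UNIV) (\<lambda>\<omega>. \<omega> i)"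
  unfolding Omega_top_def
  by (rule continuous_map_from_subtopology) (rule continuous_map_product_projection, simp)

lemma continuous_displacement:
  "continuous_map Omega_top (discrete_topology UNIV) (displacement s)"
  using continuous_discrete_binop[OF continuous_coordinate[of 0] continuous_coordinate[of "- 1"],
      of "\<lambda>l l'. if l \<in> labels s then 1 else if l' \<in> labels s then - 1 else 0"]
  unfolding displacement_def .

lemma continuous_flow: "continuous_map Omega_top Omega_top (flow s)"
proof -
  have "continuous_map Omega_top (discrete_topology UNIV) (\<lambda>\<omega>. \<omega> (n + displacement s \<omega>))" for n
  proof -
    \<comment> \<open>The displacement is 1, 0 or -1, so coordinate \<open>n\<close> of the image is
      selected among three neighbouring letters by a discrete value.\<close>
    have "continuous_map Omega_top (discrete_topology UNIV) (\<lambda>\<omega>. (\<omega> (n + 1), \<omega> n, \<omega> (n - 1)))"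
      by (rule continuous_discrete_binop[OF continuous_coordinate
            continuous_discrete_binop[OF continuous_coordinate continuous_coordinate, where h = Pair],
            where h = Pair])
    from continuous_discrete_binop[OF continuous_displacement this,
        where h = "\<lambda>k (r, c, l). if k = 1 then r else if k = - 1 then l else c"]
    show ?thesis
      by (rule continuous_map_eq) (auto simp: displacement_def)
  qed
  then have "continuous_map Omega_top (product_topology (\<lambda>_. discrete_topology UNIV) UNIV)
      (\<lambda>\<omega> n. \<omega> (n + displacement s \<omega>))"
    by (simp add: continuous_map_componentwise_UNIV)
  then have "continuous_map Omega_top Omega_top (\<lambda>\<omega> n. \<omega> (n + displacement s \<omega>))"
    by (subst (2) Omega_top_def) (auto simp: continuous_map_in_subtopology translate_Omega_tau)
  then show ?thesis
    by (rule continuous_map_eq) (simp add: flow_def)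
qed

text \<open>Being its own inverse, a continuous flow is a homeomorphism;
  \<open>displacement s\<close> is the required continuous exponent of \<open>shift\<close>.\<close>

lemma flow_in_full_group: "flow s \<in> carrier (topological_full_group Omega_top shift)"
proof -
  have "homeomorphic_maps Omega_top Omega_top (flow s) (flow s)"
    by (simp add: homeomorphic_maps_def continuous_flow flow_involution)
  then have "homeomorphic_map Omega_top Omega_top (flow s)"
    using homeomorphic_map_maps by blast
  then have "flow s \<in> carrier (homeo_group Omega_top)"
    by (simp add: homeo_group_def flow_def)
  moreover have "flow s \<omega> = (shift [^]\<^bsub>homeo_group Omega_top\<^esub> displacement s \<omega>) \<omega>"
    if "\<omega> \<in> Omega_tau" for \<omega>
    using that by (simp add: shift_int_pow flow_def)
  ultimately show ?thesis
    using continuous_displacement by (auto simp: topological_full_group_def)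
qed

lemma full_group_carrier:
  "g \<in> carrier (topological_full_group X T) \<Longrightarrow> g \<in> carrier (homeo_group X)"
  by (simp add: topological_full_group_def)

lemma full_group_mult:
  assumes "f \<in> carrier (topological_full_group X T)" "g \<in> carrier (topological_full_group X T)"
    "x \<in> topspace X"
  shows "(f \<otimes>\<^bsub>topological_full_group X T\<^esub> g) x = f (g x)"
  using homeo_group_simps[OF assms(1,2)[THEN full_group_carrier] assms(3)]
  by (simp add: topological_full_group_def)

lemma full_group_eq_one_iff:
  assumes "g \<in> carrier (topological_full_group X T)"
  shows "g = \<one>\<^bsub>topological_full_group X T\<^esub> \<longleftrightarrow> (\<forall>x\<in>topspace X. g x = x)"
proof -
  have "g \<in> extensional (topspace X)"
    using full_group_carrier[OF assms] by (simp add: homeo_group_def)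
  moreover have "\<one>\<^bsub>topological_full_group X T\<^esub> = (\<lambda>x\<in>topspace X. x)"
    by (simp add: topological_full_group_def homeo_group_def BijGroup_def)
  ultimately show ?thesis by (auto simp: extensional_def fun_eq_iff)
qed

lemma tree_aut_group_mult:
  assumes "f \<in> carrier tree_aut_group" "g \<in> carrier tree_aut_group"
  shows "f \<otimes>\<^bsub>tree_aut_group\<^esub> g = f \<circ> g"
proof -
  have "f \<in> Bij UNIV" "g \<in> Bij UNIV"
    using assms by (auto simp: tree_aut_group_def tree_auts_def Bij_def)
  then show ?thesis by (auto simp: tree_aut_group_def BijGroup_def compose_def)
qed

lemma tree_aut_group_one: "\<one>\<^bsub>tree_aut_group\<^esub> = id"
  by (auto simp: tree_aut_group_def BijGroup_def)

theorem mainTheorem5: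
  shows "\<exists>H. subgroup H (topological_full_group Omega_top shift) \<and>
    grigorchuk_group \<cong> (topological_full_group Omega_top shift)\<lparr>carrier := H\<rparr>"
proof -
  let ?F = "topological_full_group Omega_top shift"
  interpret A: group tree_aut_group by (rule group_tree_aut_group)
  interpret F: group ?F by (rule group_topological_full_group[OF shift_in_homeo_group])
  have grig: "grig s \<in> carrier tree_aut_group" for s
    using grig_in_tree_auts range_grig by blast
  have grig_invol: "grig s \<otimes>\<^bsub>tree_aut_group\<^esub> grig s = \<one>\<^bsub>tree_aut_group\<^esub>" for s
    unfolding tree_aut_group_mult[OF grig grig] tree_aut_group_one
    by (cases s) (simp_all add: fun_eq_iff grig_involutions)
  have flow_invol: "flow s \<otimes>\<^bsub>?F\<^esub> flow s = \<one>\<^bsub>?F\<^esub>" for s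
    using full_group_eq_one_iff[OF F.m_closed[OF flow_in_full_group flow_in_full_group]]
    by (simp add: full_group_mult[OF flow_in_full_group flow_in_full_group] flow_involution)
  have grig_word: "word_prod tree_aut_group grig w = foldr grig w" for w
  proof (induction w)
    case (Cons i w)
    then show ?case
      using tree_aut_group_mult[OF grig A.word_prod_closed[of grig w, OF grig], of i]
      by (simp add: fun_eq_iff)
  qed (simp add: tree_aut_group_one id_def)
  have flow_word_closed: "word_prod ?F flow w \<in> carrier ?F" for w
    by (simp add: flow_in_full_group)
  have flow_word: "word_prod ?F flow w \<omega> = (\<lambda>n. \<omega> (n + walk \<omega> w 0))" if "\<omega> \<in> Omega_tau" for w \<omega>
  proof (induction w)
    case Nil
    then show ?case
      using full_group_eq_one_iff[OF F.one_closed] that by simp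
  next
    case (Cons s w)
    have "word_prod ?F flow (s # w) \<omega> = flow s (word_prod ?F flow w \<omega>)"
      using full_group_mult[OF flow_in_full_group[of s] flow_word_closed[of w]] that by simp
    then show ?case using Cons.IH flow_translate[OF that] by simp
  qed
  \<comment> \<open>The relator conditions of the two groups become the two sides of
    \<open>grig_relator_iff\<close>.\<close>
  have "word_prod tree_aut_group grig w = \<one>\<^bsub>tree_aut_group\<^esub> \<longleftrightarrow> (\<forall>v. foldr grig w v = v)" for w
    by (simp add: grig_word tree_aut_group_one fun_eq_iff)
  moreover have "word_prod ?F flow w = \<one>\<^bsub>?F\<^esub> \<longleftrightarrow>
      (\<forall>\<omega>\<in>Omega_tau. \<forall>n. \<omega> (n + walk \<omega> w 0) = \<omega> n)" for w
    using full_group_eq_one_iff[OF flow_word_closed[of w]]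
    by (simp add: flow_word fun_eq_iff)
  ultimately have "tree_aut_group\<lparr>carrier := generate tree_aut_group (range grig)\<rparr>
      \<cong> ?F\<lparr>carrier := generate ?F (range flow)\<rparr>"
    using grig grig_invol flow_in_full_group flow_invol grig_relator_iff
    by (intro generate_iso_of_same_relators) (auto intro: A.group_axioms F.group_axioms)
  moreover have "subgroup (generate ?F (range flow)) ?F"
    by (rule F.generate_is_subgroup) (auto intro: flow_in_full_group)
  ultimately show ?thesis
    unfolding grigorchuk_group_def range_grig by blast
qed

end
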